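(* The set of positive real numbers $x$ that have eventually greedy best Egyptian underapproximations has Lebesgue measure zero.
   Context: For a positive integer $n$, a rational number $q\in[0,\infty)$ is an $n$-term Egyptian underapproximation of a real number $x\in(0,\infty)$ if $q=\sum_{k=1}^{n}1/m_k<x$ for some positive integers $m_1<m_2<\cdots<m_n$. By convention, $0$ is the unique $0$-term Egyptian underapproximation of every $x>0$. The best $n$-term Egyptian underapproximation of $x$ is the largest $n$-term Egyptian underapproximation of $x$ (it always exists). A number $x\in(0,\infty)$ has eventually greedy best Egyptian underapproximations if there exist a strictly increasing sequence of positive integers $(m_k)_{k=1}^{\infty}$ and an integer $n_0\ge 0$ such that for every $n\ge n_0$ the sum $\sum_{k=1}^{n}1/m_k$ equals the best $n$-term Egyptian underapproximation of $x$. *)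

theory Defs
  imports "HOL-Analysis.Analysis"
begin

text \<open>Sequences are indexed from 1; the value \<open>m 0\<close> is never used. The rationality and the
  nonnegativity of \<open>q\<close> follow from its being a finite sum of unit fractions.\<close>

definition egyptian_underapprox :: "nat \<Rightarrow> real \<Rightarrow> real \<Rightarrow> bool" where
  "egyptian_underapprox n x q \<longleftrightarrow>
     (\<exists>m :: nat \<Rightarrow> nat. (\<forall>k\<in>{1..n}. 0 < m k) \<and> strict_mono_on {1..n} m \<and>
        q = (\<Sum>k=1..n. 1 / real (m k))) \<and> q < x"

definition is_best_egyptian_underapprox :: "nat \<Rightarrow> real \<Rightarrow> real \<Rightarrow> bool" where
  "is_best_egyptian_underapprox n x q \<longleftrightarrow>
     egyptian_underapprox n x q \<and> (\<forall>q'. egyptian_underapprox n x q' \<longrightarrow> q' \<le> q)"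

definition eventually_greedy_best :: "real \<Rightarrow> bool" where
  "eventually_greedy_best x \<longleftrightarrow>
     (\<exists>m :: nat \<Rightarrow> nat. (\<forall>k\<ge>1. 0 < m k) \<and> strict_mono_on {1..} m \<and>
        (\<exists>n0::nat. \<forall>n\<ge>n0. is_best_egyptian_underapprox n x (\<Sum>k=1..n. 1 / real (m k))))"

text \<open>The convention for \<open>n = 0\<close> is an instance of the definition (empty sum).\<close>

lemma egyptian_underapprox_0:
  assumes "0 < x"
  shows "egyptian_underapprox 0 x q \<longleftrightarrow> q = 0"
  using assms by (auto simp: egyptian_underapprox_def strict_mono_on_def)

lemma egyptian_underapprox_rational:
  assumes "egyptian_underapprox n x q"
  shows "q \<in> \<rat>" and "0 \<le> q"
  using assms by (auto simp: egyptian_underapprox_def intro!: sum_nonneg Rats_sum Rats_divide)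

lemma is_best_egyptian_underapprox_unique:
  assumes "is_best_egyptian_underapprox n x q" "is_best_egyptian_underapprox n x q'"
  shows "q = q'"
  using assms by (meson is_best_egyptian_underapprox_def order_antisym)

end

(* If x is eventually greedy, then x = q + r with q rational and r small, and from r on the
   denominators m of the best approximations are produced by the greedy map r |-> r - 1/m,
   1/m < r <= 1/(m-1). This map has full branches: on the cylinder of the digit m the new remainder
   t runs linearly over (0, 1/(m(m-1))]. If k is the next digit, the greedy pair 1/m + 1/k is beaten
   by 1/(m+1) + 1/b as soon as 1/k < p < t, where p = 1/b - 1/M and M = m(m+1). Writing b = M - j,
   one has 1/p = M^2/j - M, and for a positive proportion of j of order M the fractional part of
   M^2/j is at least 1/4, so that a fixed proportion of the remainders t is excluded, uniformly in m.
   Iterating, the set of remainders that are never excluded is null; translate it by all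
   rational q. *)

theory Submission
  imports Defs
begin

section \<open>Fractional parts of M^2/j and the bad next digits\<close>

text \<open>The difference is M^2/(j(j+1)), so it is controlled by j/M. The constants 97/200 and
  23/50 lie just below 2/sqrt 17 and just above 2/sqrt 19, which confines the difference to the
  middle half of [4, 5].\<close>

lemma reciprocal_gap:
  fixes M :: real and j :: nat
  assumes "0 < M" "1 \<le> j" "real j + 1 \<le> 97/200 * M"
  shows "17/4 \<le> M\<^sup>2 / j - M\<^sup>2 / (j + 1)"
    and "23/50 * M \<le> j \<Longrightarrow> M\<^sup>2 / j - M\<^sup>2 / (j + 1) \<le> 19/4"
proof -
  have eq: "M\<^sup>2 / j - M\<^sup>2 / (j + 1) = M\<^sup>2 / (real j * (real j + 1))"
    using assms(2) by (simp add: field_simps)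
  have pos: "0 < real j * (real j + 1)" using assms(2) by simp
  have "real j * (real j + 1) \<le> (97/200 * M) * (97/200 * M)"
    by (rule mult_mono) (use assms in auto)
  also have "\<dots> \<le> 4/17 * M\<^sup>2" using assms(1) by (simp add: power2_eq_square)
  finally show "17/4 \<le> M\<^sup>2 / j - M\<^sup>2 / (j + 1)"
    unfolding eq using pos by (simp add: pos_le_divide_eq)
  assume "23/50 * M \<le> j"
  then have "(23/50 * M) * (23/50 * M) \<le> real j * (real j + 1)"
    by (intro mult_mono) (use assms in auto)
  moreover have "4/19 * M\<^sup>2 \<le> (23/50 * M) * (23/50 * M)"
    using assms(1) by (simp add: power2_eq_square)
  ultimately have "4/19 * M\<^sup>2 \<le> real j * (real j + 1)" by linarith
  then show "M\<^sup>2 / j - M\<^sup>2 / (j + 1) \<le> 19/4"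
    unfolding eq using pos by (simp add: pos_divide_le_eq)
qed

text \<open>By \<open>reciprocal_gap\<close> the values at \<open>j\<close> and \<open>j + 1\<close> differ by an amount at distance at least
  \<open>1/4\<close> from every integer, so their fractional parts cannot both be below \<open>1/4\<close>.\<close>

lemma not_both_near_floor:
  fixes M :: real and j :: nat
  assumes "0 < M" "1 \<le> j" "23/50 * M \<le> j" "real j + 1 \<le> 97/200 * M"
  obtains j' and k :: int where "j' \<in> {j, j + 1}"
    "real_of_int k - 3/4 \<le> M\<^sup>2 / real j' - M" "M\<^sup>2 / real j' - M < real_of_int k"
proof -
  define Q where "Q j = M\<^sup>2 / real j - M" for j
  define u v where "u = \<lfloor>Q j\<rfloor>" and "v = \<lfloor>Q (j + 1)\<rfloor>"
  have gap: "17/4 \<le> Q j - Q (j + 1)" "Q j - Q (j + 1) \<le> 19/4"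
    using reciprocal_gap[of M j] assms by (auto simp: Q_def add.commute)
  have u: "of_int u \<le> Q j" "Q j < of_int u + 1" and v: "of_int v \<le> Q (j + 1)" "Q (j + 1) < of_int v + 1"
    by (auto simp: u_def v_def)
  consider "of_int u + 1/4 \<le> Q j" | "of_int v + 1/4 \<le> Q (j + 1)"
    | "Q j < of_int u + 1/4" "Q (j + 1) < of_int v + 1/4"
    by linarith
  then show thesis
  proof cases
    case 1
    \<comment> \<open>The integer is the floor plus 1; a fractional part of at least 1/4 leaves it
      at most 3/4 above the value.\<close>
    then show ?thesis using u by (intro that[of j "u + 1"]) (auto simp: Q_def)
  next
    case 2
    then show ?thesis using v by (intro that[of "j + 1" "v + 1"]) (auto simp: Q_def)
  next
    case 3
    then have "real_of_int 4 < of_int (u - v)" "of_int (u - v) < real_of_int 5"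
      using gap u(1) v(1) by auto
    then have False unfolding of_int_less_iff by linarith
    then show ?thesis ..
  qed
qed

text \<open>Each pair of neighbouring admissible j supplies one digit \<open>k\<close>, and
  different pairs supply different digits. With p = 1/b - 1/M the condition on \<open>k\<close>
  reads 1/k < p <= 1/(k - 3/4): the cut p falls inside the cylinder of \<open>k\<close>, and less
  than 3/4 of its length lies below p.\<close>

lemma many_bad_digits:
  fixes m :: nat
  assumes "100 \<le> m"
  defines "M \<equiv> real (m * (m + 1))"
  obtains K :: "nat set" where "finite K" "M / 100 \<le> card K"
    "\<And>k. k \<in> K \<Longrightarrow> M < k \<and> k \<le> 6/5 * M \<and>
       (\<exists>b::nat. m + 1 < b \<and> 1 / M < 1 / b \<and>
          k - 3/4 \<le> 1 / (1 / b - 1 / M) \<and> 1 / (1 / b - 1 / M) < k)"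
proof -
  define Q where "Q j = M\<^sup>2 / real j - M" for j
  have Mnat: "10100 \<le> m * (m + 1)" using mult_le_mono[of 100 m 101 "m + 1"] assms(1) by simp
  have M: "10100 \<le> M" unfolding M_def using Mnat by linarith
  \<comment> \<open>The window for j is halved because \<open>i\<close> indexes the disjoint pairs
    {2i, 2i+1}. Its length M/80 leaves room for rounding above the required M/100.\<close>
  define I where "I = {nat \<lceil>23/100 * M\<rceil> ..< nat \<lfloor>97/400 * M\<rfloor>}"
  have I: "23/50 * M \<le> real (2 * i)" "real (2 * i) + 2 \<le> 97/200 * M" if "i \<in> I" for i
  proof -
    have "\<lceil>23/100 * M\<rceil> \<le> int i" "int i + 1 \<le> \<lfloor>97/400 * M\<rfloor>"
      using that unfolding I_def by (simp_all only: atLeastLessThan_iff) linarith+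
    then show "23/50 * M \<le> real (2 * i)" "real (2 * i) + 2 \<le> 97/200 * M"
      unfolding ceiling_le_iff le_floor_iff by auto
  qed
  have "\<exists>k j. j \<in> {2*i, 2*i+1} \<and> k - 3/4 \<le> Q j \<and> Q j < real k" if i: "i \<in> I" for i
  proof -
    from I[OF i] M have i1: "1 \<le> 2 * i" by linarith
    obtain j and k :: int where j: "j \<in> {2*i, 2*i+1}" "k - 3/4 \<le> Q j" "Q j < k"
      by (rule not_both_near_floor[of M "2*i"]) (use I[OF i] i1 M in \<open>auto simp: Q_def\<close>)
    have jp: "0 < real j" "real j \<le> M" using j(1) I[OF i] M by auto
    then have "M * j \<le> M\<^sup>2" using M by (auto simp: power2_eq_square intro: mult_left_mono)
    \<comment> \<open>Nonnegativity makes the integer above \<open>Q j\<close> positive, so it can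
      be taken as a natural number.\<close>
    then have "0 \<le> Q j" using jp by (simp add: Q_def pos_le_divide_eq)
    with j have "real (nat k) = k" by simp
    with j show ?thesis by (metis)
  qed
  then obtain kk jj where kj: "\<And>i. i \<in> I \<Longrightarrow> jj i \<in> {2*i, 2*i+1} \<and> kk i - 3/4 \<le> Q (jj i) \<and> Q (jj i) < real (kk i)"
    by metis
  have jr: "1 \<le> jj i" "23/50 * M \<le> real (jj i)" "real (jj i) + 1 \<le> 97/200 * M" if "i \<in> I" for i
    using kj[OF that] I[OF that] M by auto
  \<comment> \<open>A later pair lowers \<open>Q\<close> by at least 17/4, while each digit exceeds
    its value of \<open>Q\<close> by at most 3/4.\<close>
  have less: "kk i' < kk i" if ii: "i \<in> I" "i' \<in> I" "i < i'" for i i'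
  proof -
    have jj: "jj i + 1 \<le> jj i'" using kj[OF ii(1)] kj[OF ii(2)] ii(3) by auto
    have "Q (jj i') \<le> Q (jj i + 1)"
      unfolding Q_def using jj M by (intro diff_right_mono divide_left_mono) auto
    also have "\<dots> \<le> Q (jj i) - 17/4"
      using reciprocal_gap(1)[OF _ jr(1,3)[OF ii(1)]] M unfolding Q_def by linarith
    finally show ?thesis using kj[OF ii(1)] kj[OF ii(2)] by linarith
  qed
  have "inj_on kk I"
    by (rule linorder_inj_onI) (use less in force)+
  then have card: "card (kk ` I) = card I" by (rule card_image)
  have "1/80 * M - 2 \<le> real (card I)"
    unfolding I_def using M by (simp; linarith)
  then have "M / 100 \<le> card (kk ` I)" unfolding card using M by linarith
  moreover have "M < k \<and> k \<le> 6/5 * M \<and> (\<exists>b::nat. m + 1 < b \<and> 1 / M < 1 / b \<and>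
          k - 3/4 \<le> 1 / (1 / b - 1 / M) \<and> 1 / (1 / b - 1 / M) < k)" if "k \<in> kk ` I" for k
  proof -
    obtain i where i: "i \<in> I" "k = kk i" using \<open>k \<in> kk ` I\<close> by blast
    define j where "j = jj i"
    have j: "1 \<le> j" "23/50 * M \<le> j" "j + 1 \<le> 97/200 * M" and k: "k - 3/4 \<le> Q j" "Q j < k"
      using jr[OF i(1)] kj[OF i(1)] by (auto simp: j_def i(2))
    have "M\<^sup>2 / j \<le> M\<^sup>2 / (23/50 * M)"
      by (rule divide_left_mono) (use j M in auto)
    moreover have "M\<^sup>2 / (97/200 * M) \<le> M\<^sup>2 / j"
      by (rule divide_left_mono) (use j M in auto)
    ultimately have Qb: "53/50 * M \<le> Q j" "Q j \<le> 587/500 * M"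
      using M by (auto simp: Q_def power2_eq_square)
    define b where "b = m * (m + 1) - j"
    have jM: "real j < M" using j M by linarith
    then have b: "real b = M - j" unfolding b_def M_def by (simp only: of_nat_less_iff of_nat_diff[OF less_imp_le])
    \<comment> \<open>Since j < M/2 and M >= 100(m + 1), the second denominator \<open>b\<close> of
      the competitor exceeds the first, \<open>m + 1\<close>.\<close>
    have "100 * (m + 1) \<le> m * (m + 1)" using assms(1) by (intro mult_right_mono) auto
    then have "real (100 * (m + 1)) \<le> M" unfolding M_def by (rule of_nat_mono)
    then have "100 * (real m + 1) \<le> M" by simp
    then have "real (m + 1) < real b" unfolding b using j M by simp
    then have "m + 1 < b" by linarith
    moreover have "1 / M < 1 / b" using b jM j M by (intro divide_strict_left_mono) auto
    moreover have "1 / (1 / b - 1 / M) = Q j"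
    proof -
      have "0 < real b" "0 < real j" "0 < M" using b jM j M by auto
      then have "1 / b - 1 / M = j / (b * M)" using b by (simp add: diff_frac_eq)
      then have "1 / (1 / b - 1 / M) = (M - j) * M / j" using b by simp
      also have "\<dots> = Q j" using \<open>0 < real j\<close> by (simp add: Q_def field_simps power2_eq_square)
      finally show ?thesis .
    qed
    ultimately show ?thesis using k Qb M by (auto intro!: exI[of _ b])
  qed
  ultimately show ?thesis using that[of "kk ` I"] by (simp add: I_def)
qed

section \<open>The greedy map and its cylinders\<close>

text \<open>For y > 0 this is the least d with 1/d < y. It is the floor plus 1, not the ceiling,
  because underapproximations are strict.\<close>

definition next_denom :: "real \<Rightarrow> real" where
  "next_denom y = of_int \<lfloor>1 / y\<rfloor> + 1"

definition greedy_rest :: "real \<Rightarrow> real" where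
  "greedy_rest y = y - 1 / next_denom y"

text \<open>Only competitors whose first denominator exceeds the greedy one by exactly 1 are considered;
  they already suffice.\<close>

definition improvable :: "real \<Rightarrow> bool" where
  "improvable y \<longleftrightarrow> (\<exists>b::nat. next_denom y + 1 < b \<and>
     1 / next_denom y + 1 / next_denom (greedy_rest y) < 1 / (next_denom y + 1) + 1 / b \<and>
     1 / (next_denom y + 1) + 1 / b < y)"

text \<open>Quantifying over the whole orbit makes the set forward invariant, so a measure bound at
  small scales can be fed back into itself.\<close>

definition never_improvable :: "real set" where
  "never_improvable = {y. 0 < y \<and> (\<forall>n. \<not> improvable ((greedy_rest ^^ n) y))}"

lemma next_denom_eqI:
  assumes "real k - 1 \<le> 1 / y" "1 / y < real k"
  shows "next_denom y = real k"
proof -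
  have "\<lfloor>1 / y\<rfloor> = int k - 1" using assms by (intro floor_unique) auto
  then show ?thesis by (simp add: next_denom_def)
qed

text \<open>The cylinder with index \<open>l\<close> belongs to the digit \<open>Suc l\<close>; it
  is closed on the right because 1/l is not strictly below itself.\<close>

lemma next_denom_cylinder:
  assumes "1 \<le> l" "y \<in> {1 / real (Suc l)<..1 / real l}"
  shows "next_denom y = real (Suc l)"
proof -
  have "0 < 1 / real (Suc l)" by simp
  then have "0 < y" using assms(2) unfolding greaterThanAtMost_iff by linarith
  then show ?thesis using assms by (intro next_denom_eqI) (auto simp: field_simps)
qed

lemma greedy_rest_pos:
  assumes "0 < y"
  shows "0 < greedy_rest y"
proof -
  have "1 / y < next_denom y" "0 < 1 / y" using assms by (auto simp: next_denom_def)
  then have "1 / next_denom y < 1 / (1 / y)" by (intro divide_strict_left_mono mult_pos_pos) linarith+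
  then show ?thesis by (simp add: greedy_rest_def)
qed

lemma never_improvable_greedy_rest:
  assumes "y \<in> never_improvable"
  shows "greedy_rest y \<in> never_improvable"
proof -
  have "\<not> improvable ((greedy_rest ^^ n) (greedy_rest y))" for n
    using assms by (auto simp: never_improvable_def simp flip: funpow_swap1 dest: spec[of _ "Suc n"])
  then show ?thesis using assms greedy_rest_pos by (auto simp: never_improvable_def)
qed

text \<open>On a cylinder the greedy map is a translation, and the length of the cylinder is
  1/(l(l+1)). Forward invariance keeps the remainder in the set, while the case n = 0 of its
  definition excludes improvement at the first step.\<close>

lemma never_improvable_cylinder_subset:
  assumes "1 \<le> l"
  shows "never_improvable \<inter> {1 / real (Suc l)<..1 / real l} \<subseteq>
    (+) (1 / real (Suc l)) ` {t \<in> never_improvable. t \<le> 1 / (real l * real (Suc l)) \<and>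
      \<not> improvable (1 / real (Suc l) + t)}"
proof
  fix y assume y: "y \<in> never_improvable \<inter> {1 / real (Suc l)<..1 / real l}"
  then have rest: "greedy_rest y = y - 1 / real (Suc l)"
    using next_denom_cylinder[OF assms, of y] by (simp add: greedy_rest_def)
  have "1 / real l - 1 / real (Suc l) = 1 / (real l * real (Suc l))"
    using assms by (simp add: field_simps)
  then have "greedy_rest y \<le> 1 / (real l * real (Suc l))" using y rest by auto
  moreover have "\<not> improvable y" using y unfolding never_improvable_def by (auto dest: spec[of _ 0])
  ultimately show "y \<in> (+) (1 / real (Suc l)) ` {t \<in> never_improvable.
      t \<le> 1 / (real l * real (Suc l)) \<and> \<not> improvable (1 / real (Suc l) + t)}"
    using y rest never_improvable_greedy_rest[of y] by (intro image_eqI[of _ _ "greedy_rest y"]) auto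
qed

lemma measurable_next_denom [measurable]: "next_denom \<in> borel_measurable borel"
  unfolding next_denom_def[abs_def] by measurable

lemma measurable_greedy_rest [measurable]: "greedy_rest \<in> borel_measurable borel"
  unfolding greedy_rest_def[abs_def] by measurable

lemma measurable_improvable [measurable]: "Measurable.pred borel improvable"
  unfolding improvable_def[abs_def] by measurable

lemma never_improvable_borel [measurable]: "never_improvable \<in> sets borel"
  unfolding never_improvable_def by measurable

section \<open>Measure of cylinders and of their translates\<close>

lemma greaterThanAtMost_lmeasurable: "{a<..b::real} \<in> lmeasurable"
  by (rule bounded_set_imp_lmeasurable) auto

lemma never_improvable_lmeasurable: "never_improvable \<inter> {a<..b} \<in> lmeasurable"
  using fmeasurable_Int_fmeasurable[OF greaterThanAtMost_lmeasurable, of never_improvable a b]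
  by (simp add: Int_commute)

lemma measure_le_translated:
  assumes "B \<in> sets lebesgue" "B \<subseteq> (+) a ` (never_improvable \<inter> {0<..h})" "h \<le> h'"
  shows "measure lebesgue B \<le> measure lebesgue (never_improvable \<inter> {0<..h'})"
proof -
  have "measure lebesgue B \<le> measure lebesgue ((+) a ` (never_improvable \<inter> {0<..h'}))"
  proof (rule measure_mono_fmeasurable)
    have "never_improvable \<inter> {0<..h} \<subseteq> never_improvable \<inter> {0<..h'}" using assms(3) by auto
    then show "B \<subseteq> (+) a ` (never_improvable \<inter> {0<..h'})" using assms(2) by blast
  qed (use assms(1) measurable_translation never_improvable_lmeasurable in auto)
  then show ?thesis by (simp add: measure_translation)
qed

text \<open>Splitting off finitely many cylinders and keeping the tail (0, 1/n] avoids infinite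
  sums.\<close>

lemma measure_le_sum_cylinders:
  assumes "A \<in> sets lebesgue" "1 \<le> l" "l \<le> n"
  shows "measure lebesgue (A \<inter> {0<..1 / real l}) \<le>
    (\<Sum>k=l..<n. measure lebesgue (A \<inter> {1 / real (Suc k)<..1 / real k})) +
    measure lebesgue (A \<inter> {0<..1 / real n})"
  using assms(3)
proof (induction n rule: dec_induct)
  case base
  then show ?case by simp
next
  case (step n)
  have "1 / real (Suc n) \<le> 1 / real n" using step assms(2) by (simp add: field_simps)
  then have "A \<inter> {0<..1 / real n} = (A \<inter> {1 / real (Suc n)<..1 / real n}) \<union> (A \<inter> {0<..1 / real (Suc n)})"
    using less_trans[of 0 "1 / real (Suc n)"] by (auto simp del: of_nat_Suc)
  then have "measure lebesgue (A \<inter> {0<..1 / real n}) \<le>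
      measure lebesgue (A \<inter> {1 / real (Suc n)<..1 / real n}) + measure lebesgue (A \<inter> {0<..1 / real (Suc n)})"
    using assms(1) by (simp only:) (intro measure_Un_le sets.Int; simp)
  then show ?case using step by simp
qed

lemma sum_inverse_telescope:
  assumes "1 \<le> l" "l \<le> n"
  shows "(\<Sum>k=l..<n. 1 / (real k * real (Suc k))) = 1 / real l - 1 / real n"
  using assms(2)
proof (induction n rule: dec_induct)
  case (step n)
  moreover have "1 / (real n * real (Suc n)) = 1 / real n - 1 / real (Suc n)"
    using step assms(1) by (simp add: field_simps)
  ultimately show ?case by simp
qed simp

text \<open>The two-term competitor \<open>1/(m + 1) + 1/b\<close> equals \<open>1/m + p\<close> with
  \<open>p = 1/b - 1/(m(m + 1))\<close>, so a remainder \<open>t > p\<close> in the cylinder of the digit \<open>k\<close>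
  is excluded as soon as \<open>1/k < p\<close>.\<close>

lemma measure_bad_cylinder:
  fixes n l b :: nat and \<beta> :: real
  assumes n: "100 \<le> n" and l: "n * (n + 1) \<le> l"
    and b: "n + 2 < b" and k: "Suc l - 3/4 \<le> 1 / (1 / b - 1 / real ((n + 1) * (n + 2)))"
      "1 / (1 / b - 1 / real ((n + 1) * (n + 2))) < Suc l" "1 / real ((n + 1) * (n + 2)) < 1 / b"
    and bound: "\<And>q. 100 \<le> q \<Longrightarrow> measure lebesgue (never_improvable \<inter> {0<..1 / real q}) \<le> \<beta> / q"
    and "0 \<le> \<beta>"
    and A: "A \<in> sets lebesgue" "A \<subseteq> {t \<in> never_improvable. t \<le> 1 / (real n * real (Suc n)) \<and>
      \<not> improvable (1 / real (Suc n) + t)}"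
  shows "measure lebesgue (A \<inter> {1 / real (Suc l)<..1 / real l}) \<le> 7/8 * (\<beta> / (real l * real (Suc l)))"
proof -
  define p where "p = 1 / b - 1 / real ((n + 1) * (n + 2))"
  have p: "0 < p" "Suc l - 3/4 \<le> 1 / p" "1 / p < Suc l" using k by (auto simp: p_def)
  have "100 * 101 \<le> n * (n + 1)" using mult_le_mono[of 100 n 101 "n + 1"] n by simp
  then have l100: "10100 \<le> l" using l by linarith
  have kp: "1 / real (Suc l) < p" using p by (simp add: field_simps)
  have split: "1 / (real (Suc n) + 1) + 1 / b = 1 / real (Suc n) + p"
  proof -
    have "1 / x - 1 / (x + 1) = 1 / (x * (x + 1))" if "0 < x" for x :: real
      using that by (simp add: field_simps)
    from this[of "real (Suc n)"]
    have "1 / real (Suc n) - 1 / (real (Suc n) + 1) = 1 / real ((n + 1) * (n + 2))"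
      by (simp add: algebra_simps)
    then show ?thesis by (simp add: p_def)
  qed
  have le_p: "t \<le> p" if t: "t \<in> A \<inter> {1 / real (Suc l)<..1 / real l}" for t
  proof (rule ccontr)
    assume "\<not> t \<le> p"
    define y where "y = 1 / real (Suc n) + t"
    have "0 < t" "t \<le> 1 / (real n * real (Suc n))" using t A(2) by (auto simp: never_improvable_def)
    moreover have "1 / real (Suc n) + 1 / (real n * real (Suc n)) = 1 / real n"
      using n by (simp add: divide_simps)
    ultimately have "y \<in> {1 / real (Suc n)<..1 / real n}" by (auto simp: y_def)
    then have den: "next_denom y = real (Suc n)" using n by (intro next_denom_cylinder) auto
    then have "greedy_rest y = t" by (simp add: greedy_rest_def y_def)
    moreover have "next_denom t = real (Suc l)" using t l100 by (intro next_denom_cylinder) auto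
    ultimately have "improvable y"
      unfolding improvable_def den using b split kp \<open>\<not> t \<le> p\<close> by (intro exI[of _ b]) (auto simp: y_def)
    then show False using t A(2) by (auto simp: y_def)
  qed
  \<comment> \<open>The part below the cut has length at most (3/4)/(l(l+1)), but
    \<open>bound\<close> only covers reciprocals of integers. The factor 5/4 lies between 8/7 and
    4/3, so it survives rounding down, and 3/4 is relaxed to 7/8.\<close>
  define q where "q = 5 * (l * Suc l) div 4"
  have "10100 * 1 \<le> l * Suc l" using l100 by (intro mult_le_mono) auto
  then have q: "100 \<le> q" "8/7 * (real l * real (Suc l)) \<le> q" "q \<le> 4/3 * (real l * real (Suc l))"
    unfolding q_def of_nat_mult[symmetric] by linarith+
  have "p - 1 / real (Suc l) \<le> 1 / real q"
  proof -
    have "p \<le> 1 / (Suc l - 3/4)" using p l100 by (simp add: field_simps)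
    then have "p - 1 / real (Suc l) \<le> 1 / (Suc l - 3/4) - 1 / real (Suc l)" by (rule diff_right_mono)
    also have "\<dots> = 3/4 * (1 / (real (Suc l) * (Suc l - 3/4)))"
      using l100 by (simp add: divide_simps)
    also have "\<dots> \<le> 3/4 * (1 / (real l * real (Suc l)))"
      using l100 by (intro mult_left_mono divide_left_mono) (auto simp: mult.commute)
    also have "\<dots> = 1 / (4/3 * (real l * real (Suc l)))" by simp
    also have "\<dots> \<le> 1 / q" using q l100 by (intro divide_left_mono) auto
    finally show ?thesis .
  qed
  \<comment> \<open>One further greedy step moves what is left of the cylinder to remainders in (0,
    p - 1/(l+1)], where \<open>bound\<close> applies at a finer scale.\<close>
  moreover have "A \<inter> {1 / real (Suc l)<..1 / real l} \<subseteq>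
      (+) (1 / real (Suc l)) ` (never_improvable \<inter> {0<..p - 1 / real (Suc l)})"
  proof
    fix t assume t: "t \<in> A \<inter> {1 / real (Suc l)<..1 / real l}"
    then have "t \<in> never_improvable \<inter> {1 / real (Suc l)<..1 / real l}" using A(2) by auto
    then obtain s where "s \<in> never_improvable" "t = 1 / real (Suc l) + s"
      using never_improvable_cylinder_subset[of l] l100 by auto
    then show "t \<in> (+) (1 / real (Suc l)) ` (never_improvable \<inter> {0<..p - 1 / real (Suc l)})"
      using le_p[OF t] by (intro image_eqI[of _ _ s]) (auto simp: never_improvable_def)
  qed
  ultimately have "measure lebesgue (A \<inter> {1 / real (Suc l)<..1 / real l}) \<le>
      measure lebesgue (never_improvable \<inter> {0<..1 / real q})"
    using A(1) by (intro measure_le_translated) (auto intro: sets.Int)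
  also have "\<dots> \<le> \<beta> / q" using bound q(1) .
  also have "\<dots> \<le> \<beta> / (8/7 * (real l * real (Suc l)))"
    using q l100 \<open>0 \<le> \<beta>\<close> by (intro divide_left_mono) auto
  finally show ?thesis by simp
qed

text \<open>One greedy step moves the cylinder into (0, 1/(l(l+1))], whose endpoint is the
  reciprocal of an integer that is at least 100 because \<open>10 \<le> l\<close>.\<close>

lemma measure_cylinder_le:
  fixes \<beta> :: real
  assumes l: "10 \<le> l"
    and bound: "\<And>q. 100 \<le> q \<Longrightarrow> measure lebesgue (never_improvable \<inter> {0<..1 / real q}) \<le> \<beta> / q"
  shows "measure lebesgue (never_improvable \<inter> {1 / real (Suc l)<..1 / real l}) \<le> \<beta> / (real l * real (Suc l))"
proof -
  have "measure lebesgue (never_improvable \<inter> {1 / real (Suc l)<..1 / real l}) \<le>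
      measure lebesgue (never_improvable \<inter> {0<..1 / real (l * Suc l)})"
  proof (rule measure_le_translated)
    show "never_improvable \<inter> {1 / real (Suc l)<..1 / real l} \<subseteq>
        (+) (1 / real (Suc l)) ` (never_improvable \<inter> {0<..1 / real (l * Suc l)})"
      (is "?C \<subseteq> _ ` ?S")
    proof -
      have "?C \<subseteq> (+) (1 / real (Suc l)) ` {t \<in> never_improvable. t \<le> 1 / (real l * real (Suc l)) \<and>
          \<not> improvable (1 / real (Suc l) + t)}"
        using l by (intro never_improvable_cylinder_subset) auto
      also have "\<dots> \<subseteq> (+) (1 / real (Suc l)) ` ?S"
        by (rule image_mono) (auto simp: never_improvable_def simp del: of_nat_Suc mult_Suc_right)
      finally show ?thesis .
    qed
  qed (auto intro: sets.Int)
  also have "\<dots> \<le> \<beta> / real (l * Suc l)"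
    using mult_le_mono[of 10 l 10 "Suc l"] l by (intro bound) auto
  finally show ?thesis by (simp only: of_nat_mult)
qed

text \<open>A proportion of at least \<open>1/150\<close> of the remainders lies in cylinders that lose \<open>1/8\<close> of their
  measure, which gives the factor \<open>1 - 1/1200\<close>.\<close>

lemma measure_cylinder_contraction:
  fixes n :: nat and \<beta> :: real
  assumes n: "100 \<le> n" and "0 \<le> \<beta>"
    and bound: "\<And>q. 100 \<le> q \<Longrightarrow> measure lebesgue (never_improvable \<inter> {0<..1 / real q}) \<le> \<beta> / q"
  shows "measure lebesgue (never_improvable \<inter> {1 / real (Suc n)<..1 / real n}) \<le>
    1199/1200 * \<beta> / (real n * real (Suc n))"
proof -
  \<comment> \<open>For the digit m = n + 1 the remainders fill (0, 1/N] with N = m(m-1), while the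
    competitors involve M = m(m+1).\<close>
  define N M where "N = n * Suc n" and "M = real ((n + 1) * (n + 2))"
  define A where "A = {t \<in> never_improvable. t \<le> 1 / (real n * real (Suc n)) \<and>
      \<not> improvable (1 / real (Suc n) + t)}"
  have "A \<in> sets borel" unfolding A_def by measurable
  then have A: "A \<in> sets lebesgue" by simp
  have AN: "A \<inter> {0<..1 / real N} = A" by (auto simp: A_def N_def never_improvable_def algebra_simps)
  have "10000 \<le> N" using mult_le_mono[of 100 n 100 "Suc n"] n by (simp add: N_def)
  obtain K :: "nat set" where K: "finite K" "M / 100 \<le> card K"
    "\<And>k. k \<in> K \<Longrightarrow> M < k \<and> k \<le> 6/5 * M \<and>
       (\<exists>b::nat. n + 2 < b \<and> 1 / M < 1 / b \<and>
          k - 3/4 \<le> 1 / (1 / b - 1 / M) \<and> 1 / (1 / b - 1 / M) < k)"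
  proof (rule many_bad_digits[of "n + 1"])
  qed (use n in \<open>auto simp: M_def add.assoc\<close>)
  \<comment> \<open>R = 2M lies above all bad digits, which are at most 6M/5. The tail (0, 1/R] gets
    the plain bound, so without the losses on \<open>L\<close> the total would telescope to exactly
    \<open>\<beta> / N\<close>.\<close>
  define R where "R = 2 * ((n + 1) * (n + 2))"
  define L where "L = {l \<in> {N..<R}. Suc l \<in> K}"
  have "N \<le> R" by (simp add: N_def R_def)
  have NM: "real N \<le> M" by (simp add: N_def M_def algebra_simps)
  have "100 * real n \<le> real n * real n" using n by (intro mult_right_mono) auto
  moreover have "M = real n * real n + 3 * real n + 2" "real N = real n * real n + real n"
    by (simp_all add: M_def N_def algebra_simps)
  ultimately have "100 * M \<le> 102 * real N" using n by linarith
  have "0 < M" using NM \<open>10000 \<le> N\<close> by linarith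
  have "K \<subseteq> Suc ` L"
  proof
    fix k assume k: "k \<in> K"
    have "(n + 1) * (n + 2) < k" using K(3)[OF k] unfolding M_def by linarith
    moreover have "k \<le> R" using K(3)[OF k] \<open>0 < M\<close> unfolding M_def R_def by linarith
    ultimately have "k - 1 \<in> L" "k = Suc (k - 1)" using k NM by (auto simp: L_def N_def)
    then show "k \<in> Suc ` L" by blast
  qed
  moreover have "finite L" by (simp add: L_def)
  ultimately have "card K \<le> card L" by (rule surj_card_le[rotated])
  then have cardL: "M / 100 \<le> card L" using K(2) by linarith
  have lower: "1 / (36/25 * M\<^sup>2) \<le> 1 / (real l * real (Suc l))" if "l \<in> L" for l
  proof -
    have "Suc l \<in> K" "N \<le> l" using that by (auto simp: L_def)
    then have "real (Suc l) \<le> 6/5 * M" using K(3) by blast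
    then have "real l * real (Suc l) \<le> (6/5 * M) * (6/5 * M)" by (intro mult_mono) auto
    then show ?thesis using \<open>0 < M\<close> \<open>10000 \<le> N\<close> \<open>N \<le> l\<close> by (intro divide_left_mono) (auto simp: power2_eq_square)
  qed
  have cyl: "measure lebesgue (A \<inter> {1 / real (Suc l)<..1 / real l}) \<le>
      \<beta> * (1 / (real l * real (Suc l))) - (if l \<in> L then \<beta> / 8 * (1 / (real l * real (Suc l))) else 0)"
    if l: "l \<in> {N..<R}" for l
  proof (cases "l \<in> L")
    case True
    then obtain b :: nat where "n + 2 < b" "1 / M < 1 / b"
          "Suc l - 3/4 \<le> 1 / (1 / b - 1 / M)" "1 / (1 / b - 1 / M) < Suc l"
      using K(3)[of "Suc l"] by (auto simp: L_def)
    then have "measure lebesgue (A \<inter> {1 / real (Suc l)<..1 / real l}) \<le> 7/8 * (\<beta> / (real l * real (Suc l)))"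
      using n l A bound \<open>0 \<le> \<beta>\<close> unfolding M_def
      by (intro measure_bad_cylinder[of n l b \<beta> A]) (auto simp: N_def A_def)
    then show ?thesis using True by simp
  next
    case False
    have "measure lebesgue (A \<inter> {1 / real (Suc l)<..1 / real l}) \<le>
        measure lebesgue (never_improvable \<inter> {1 / real (Suc l)<..1 / real l})"
      using A by (intro measure_mono_fmeasurable never_improvable_lmeasurable) (auto simp: A_def)
    also have "\<dots> \<le> \<beta> / (real l * real (Suc l))"
      using l \<open>10000 \<le> N\<close> bound by (intro measure_cylinder_le) auto
    finally show ?thesis using False by simp
  qed
  have "measure lebesgue (never_improvable \<inter> {1 / real (Suc n)<..1 / real n}) \<le>
      measure lebesgue ((+) (1 / real (Suc n)) ` A)"
  proof (rule measure_mono_fmeasurable)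
    have "A \<in> lmeasurable"
      using A AN fmeasurable_Int_fmeasurable[OF greaterThanAtMost_lmeasurable, of A 0 "1 / real N"]
      by (simp add: Int_commute)
    then show "(+) (1 / real (Suc n)) ` A \<in> lmeasurable" by (rule measurable_translation)
    show "never_improvable \<inter> {1 / real (Suc n)<..1 / real n} \<subseteq> (+) (1 / real (Suc n)) ` A"
      unfolding A_def using never_improvable_cylinder_subset n by simp
  qed (auto intro: sets.Int)
  also have "\<dots> = measure lebesgue (A \<inter> {0<..1 / real N})" by (simp only: measure_translation AN)
  also have "\<dots> \<le> (\<Sum>l=N..<R. measure lebesgue (A \<inter> {1 / real (Suc l)<..1 / real l})) +
      measure lebesgue (A \<inter> {0<..1 / real R})"
    using A \<open>10000 \<le> N\<close> \<open>N \<le> R\<close> by (intro measure_le_sum_cylinders) auto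
  also have "measure lebesgue (A \<inter> {0<..1 / real R}) \<le> measure lebesgue (never_improvable \<inter> {0<..1 / real R})"
    using A by (intro measure_mono_fmeasurable never_improvable_lmeasurable) (auto simp: A_def)
  also have "\<dots> \<le> \<beta> / R" using \<open>10000 \<le> N\<close> \<open>N \<le> R\<close> by (intro bound) auto
  also have "(\<Sum>l=N..<R. measure lebesgue (A \<inter> {1 / real (Suc l)<..1 / real l})) \<le>
      (\<Sum>l=N..<R. \<beta> * (1 / (real l * real (Suc l))) -
        (if l \<in> L then \<beta> / 8 * (1 / (real l * real (Suc l))) else 0))"
    by (intro sum_mono cyl)
  also have "\<dots> = \<beta> * (\<Sum>l=N..<R. 1 / (real l * real (Suc l))) -
      \<beta> / 8 * (\<Sum>l\<in>L. 1 / (real l * real (Suc l)))"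
  proof -
    have "{N..<R} \<inter> L = L" by (auto simp: L_def)
    then show ?thesis
      using sum.inter_restrict[of "{N..<R}" "\<lambda>l. \<beta> / 8 * (1 / (real l * real (Suc l)))" L]
      by (simp only: sum_subtractf sum_distrib_left) simp
  qed
  also have "(\<Sum>l=N..<R. 1 / (real l * real (Suc l))) = 1 / N - 1 / R"
    using \<open>10000 \<le> N\<close> \<open>N \<le> R\<close> by (intro sum_inverse_telescope) auto
  also have "\<beta> * (1 / N - 1 / R) - \<beta> / 8 * (\<Sum>l\<in>L. 1 / (real l * real (Suc l))) + \<beta> / R \<le>
      \<beta> / N - \<beta> / 8 * (1 / (150 * N))"
  proof -
    \<comment> \<open>At least M/100 bad cylinders, each of length at least 1/(1.44 M^2), have total
      length at least 1/(144 M); M <= 1.02 N gives 1/(150 N).\<close>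
    have "1 / (150 * N) \<le> 1 / (144 * M)"
      using \<open>100 * M \<le> 102 * real N\<close> \<open>0 < M\<close> \<open>10000 \<le> N\<close> by (intro divide_left_mono) auto
    also have "\<dots> = M / 100 * (1 / (36/25 * M\<^sup>2))" using \<open>0 < M\<close> by (simp add: power2_eq_square)
    also have "\<dots> \<le> card L * (1 / (36/25 * M\<^sup>2))" using cardL by (intro mult_right_mono) auto
    also have "\<dots> \<le> (\<Sum>l\<in>L. 1 / (real l * real (Suc l)))" using lower by (rule sum_bounded_below)
    finally have "\<beta> / 8 * (1 / (150 * N)) \<le> \<beta> / 8 * (\<Sum>l\<in>L. 1 / (real l * real (Suc l)))"
      using \<open>0 \<le> \<beta>\<close> by (intro mult_left_mono) auto
    then show ?thesis by (simp add: right_diff_distrib)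
  qed
  also have "\<beta> / N - \<beta> / 8 * (1 / (150 * N)) = 1199/1200 * \<beta> / N"
    using \<open>10000 \<le> N\<close> by (simp add: field_simps)
  finally show ?thesis by (simp only: N_def of_nat_mult)
qed

section \<open>Iterated contraction and nullity\<close>

text \<open>Summing the contracted bounds over the cylinders k = l, ..., n-1 telescopes to the
  factor 1/l - 1/n; the uncontracted tail \<open>\<beta> / n\<close> vanishes as n grows.\<close>

lemma never_improvable_contraction:
  fixes \<beta> :: real
  assumes "0 \<le> \<beta>"
    and bound: "\<And>q. 100 \<le> q \<Longrightarrow> measure lebesgue (never_improvable \<inter> {0<..1 / real q}) \<le> \<beta> / q"
    and l: "100 \<le> l"
  shows "measure lebesgue (never_improvable \<inter> {0<..1 / real l}) \<le> 1199/1200 * \<beta> / l"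
proof (rule LIMSEQ_le_const)
  show "(\<lambda>n. 1199/1200 * \<beta> / l + \<beta> / real n) \<longlonglongrightarrow> 1199/1200 * \<beta> / l"
    by (rule tendsto_eq_intros lim_const_over_n refl)+ simp
  have "measure lebesgue (never_improvable \<inter> {0<..1 / real l}) \<le> 1199/1200 * \<beta> / l + \<beta> / real n"
    if "l \<le> n" for n
  proof -
    have "measure lebesgue (never_improvable \<inter> {0<..1 / real l}) \<le>
      (\<Sum>k=l..<n. measure lebesgue (never_improvable \<inter> {1 / real (Suc k)<..1 / real k})) +
      measure lebesgue (never_improvable \<inter> {0<..1 / real n})"
      using that l by (intro measure_le_sum_cylinders) auto
    also have "\<dots> \<le> (\<Sum>k=l..<n. 1199/1200 * \<beta> * (1 / (real k * real (Suc k)))) + \<beta> / n"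
      using that l measure_cylinder_contraction[OF _ assms(1) bound] bound
      by (intro add_mono sum_mono) auto
    also have "\<dots> = 1199/1200 * \<beta> * (1 / l - 1 / n) + \<beta> / n"
      using that l by (subst sum_distrib_left[symmetric], subst sum_inverse_telescope) auto
    also have "\<dots> \<le> 1199/1200 * \<beta> / l + \<beta> / n"
    proof -
      have "1199/1200 * \<beta> * (1 / l - 1 / n) \<le> 1199/1200 * \<beta> * (1 / l)"
        using assms(1) by (intro mult_left_mono) auto
      then show ?thesis by simp
    qed
    finally show ?thesis .
  qed
  then show "\<exists>N. \<forall>n\<ge>N. measure lebesgue (never_improvable \<inter> {0<..1 / real l}) \<le> 1199/1200 * \<beta> / l + \<beta> / real n"
    by blast
qed

text \<open>The length of the interval gives the bound with \<open>\<beta>\<close> = 1, and each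
  contraction multiplies it by 1199/1200.\<close>

lemma never_improvable_null: "never_improvable \<inter> {0<..1 / 100} \<in> null_sets lebesgue"
proof -
  have pow: "measure lebesgue (never_improvable \<inter> {0<..1 / real q}) \<le> (1199/1200) ^ i / q"
    if "100 \<le> q" for i q
    using that
  proof (induction i arbitrary: q)
    case 0
    have "measure lebesgue (never_improvable \<inter> {0<..1 / real q}) \<le> measure lebesgue {0<..1 / real q}"
      by (intro measure_mono_fmeasurable greaterThanAtMost_lmeasurable) (auto intro: sets.Int)
    then show ?case by simp
  next
    case (Suc i)
    then show ?case using never_improvable_contraction[of "(1199/1200) ^ i" q] by simp
  qed
  have "measure lebesgue (never_improvable \<inter> {0<..1 / 100}) \<le> 0"
  proof (rule LIMSEQ_le_const)
    show "(\<lambda>i. (1199/1200) ^ i / 100 :: real) \<longlonglongrightarrow> 0"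
      by (auto intro!: tendsto_divide_zero LIMSEQ_power_zero)
    show "\<exists>N. \<forall>i\<ge>N. measure lebesgue (never_improvable \<inter> {0<..1 / 100}) \<le> (1199/1200) ^ i / 100"
      using pow[of 100] by auto
  qed
  then have "measure lebesgue (never_improvable \<inter> {0<..1 / 100}) = 0"
    by (simp add: measure_le_0_iff)
  then show ?thesis
    using never_improvable_lmeasurable by (simp add: completion.complete_measure_axioms null_sets_def emeasure_eq_measure2 fmeasurableD)
qed

section \<open>From best underapproximations to greedy orbits\<close>

text \<open>The rational q is a late partial sum. Exchanging the last term of a best sum shows that
  the denominators are greedy from some point on; exchanging the last two shows that the remainders
  are not improvable.\<close>

lemma eventually_greedy_remainder:
  assumes "eventually_greedy_best x"
  obtains q where "q \<in> \<rat>" "x - q \<in> never_improvable \<inter> {0<..1 / 100}"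
proof -
  obtain m n0 where m: "\<And>k. 1 \<le> k \<Longrightarrow> 0 < m k" "strict_mono_on {1..} m"
    and best: "\<And>n. n0 \<le> n \<Longrightarrow> is_best_egyptian_underapprox n x (\<Sum>k=1..n. 1 / real (m k))"
    using assms unfolding eventually_greedy_best_def by auto
  have mono: "m i < m j" if "1 \<le> i" "i < j" for i j
    using m(2) that by (auto simp: strict_mono_on_def)
  define s where "s n = (\<Sum>k=1..n. 1 / real (m k))" for n
  define r where "r n = x - s n" for n
  have s_Suc: "s (Suc n) = s n + 1 / m (Suc n)" for n by (simp add: s_def)
  have r_Suc: "r (Suc n) = r n - 1 / m (Suc n)" for n by (simp add: r_def s_Suc)
  have r_pos: "0 < r n" if "n0 \<le> n" for n
    using best[OF that] by (simp add: is_best_egyptian_underapprox_def egyptian_underapprox_def r_def s_def)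
  have le_best: "(\<Sum>k=1..n. 1 / real (w k)) \<le> s n"
    if "n0 \<le> n" "\<And>k. k \<in> {1..n} \<Longrightarrow> 0 < w k" "strict_mono_on {1..n} w" "(\<Sum>k=1..n. 1 / real (w k)) < x" for n and w :: "nat \<Rightarrow> nat"
    using best[OF that(1)] that(2-) unfolding is_best_egyptian_underapprox_def egyptian_underapprox_def s_def by blast
  \<comment> \<open>The first \<open>n\<close> denominators are kept; \<open>m n < a\<close> keeps
    the new sequence strictly increasing.\<close>
  have ext1: "m (Suc n) \<le> a" if n: "1 \<le> n" "n0 \<le> Suc n" and a: "m n < a" "1 / a < r n" for n a :: nat
  proof -
    define w where "w = m(Suc n := a)"
    have "m i < a" if "1 \<le> i" "i \<le> n" for i
      using that a(1) mono[of i n] by (cases "i = n") auto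
    then have "strict_mono_on {1..Suc n} w" using mono by (auto simp: strict_mono_on_def w_def)
    moreover have sum: "(\<Sum>k=1..Suc n. 1 / real (w k)) = s n + 1 / a"
      by (simp add: s_def w_def)
    moreover have "s n + 1 / a < x" using a(2) by (simp add: r_def)
    ultimately have "s n + 1 / a \<le> s (Suc n)"
      using le_best[of "Suc n" w] n(2) m(1) a(1) by (auto simp: w_def)
    then have "1 / real a \<le> 1 / m (Suc n)" by (simp add: s_Suc)
    then show ?thesis using a(1) m(1)[of "Suc n"] by (simp add: field_simps)
  qed
  have ext2: "1 / a + 1 / b \<le> 1 / m (Suc n) + 1 / m (Suc (Suc n))"
    if n: "1 \<le> n" "n0 \<le> Suc n" and a: "m n < a" "a < b" "1 / a + 1 / b < r n" for n a b :: nat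
  proof -
    define w where "w = m(Suc n := a, Suc (Suc n) := b)"
    have "m i < a" if "1 \<le> i" "i \<le> n" for i
      using that a(1) mono[of i n] by (cases "i = n") auto
    then have "strict_mono_on {1..Suc (Suc n)} w" using mono a(2)
      by (fastforce simp: strict_mono_on_def w_def)
    moreover have "(\<Sum>k=1..Suc (Suc n). 1 / real (w k)) = s n + 1 / a + 1 / b"
      by (simp add: s_def w_def)
    moreover have "s n + 1 / a + 1 / b < x" using a(3) by (simp add: r_def)
    ultimately have "s n + 1 / a + 1 / b \<le> s (Suc (Suc n))"
      using le_best[of "Suc (Suc n)" w] n(2) m(1) a(1,2) by (auto simp: w_def)
    then show ?thesis by (simp add: s_Suc)
  qed
  \<comment> \<open>The maximum with 1 is taken because nothing is known about
    \<open>m 0\<close>.\<close>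
  define N where "N = max 1 n0"
  \<comment> \<open>The gap makes \<open>m (Suc n) - 1\<close> an admissible denominator, so
    optimality forces its reciprocal to be at least \<open>r n\<close>. Without a gap the greedy
    denominator might already have been used.\<close>
  have greedy: "r n \<le> 1 / (real (m (Suc n)) - 1)" "next_denom (r n) = m (Suc n)" "greedy_rest (r n) = r (Suc n)"
    if n: "N \<le> n" and gap: "m n + 1 < m (Suc n)" for n
  proof -
    have "m n < m (Suc n) - 1" "\<not> m (Suc n) \<le> m (Suc n) - 1" using gap by linarith+
    then have "\<not> 1 / real (m (Suc n) - 1) < r n"
      using ext1[of n "m (Suc n) - 1"] n by (auto simp: N_def)
    then show le: "r n \<le> 1 / (real (m (Suc n)) - 1)" using gap by (simp add: of_nat_diff)
    have lt: "1 / m (Suc n) < r n" using r_pos[of "Suc n"] n by (simp add: r_Suc N_def)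
    have "0 < r n" using r_pos n by (simp add: N_def)
    then show *: "next_denom (r n) = m (Suc n)"
      using le lt gap by (intro next_denom_eqI) (auto simp: field_simps)
    show "greedy_rest (r n) = r (Suc n)" by (simp add: greedy_rest_def * r_Suc)
  qed
  text \<open>If consecutive denominators never left a gap, the harmonic series would be bounded by \<open>x\<close>.\<close>
  obtain n1 where n1: "N \<le> n1" "m n1 + 1 < m (Suc n1)"
  proof (rule ccontr)
    assume "\<not> thesis"
    then have no_gap: "m (Suc n) = m n + 1" if "N \<le> n" for n
      using that mono[of n "Suc n"] \<open>\<And>n1. N \<le> n1 \<Longrightarrow> m n1 + 1 < m (Suc n1) \<Longrightarrow> thesis\<close>[of n]
      by (fastforce simp: N_def)
    have arith: "m (N + k) = m N + k" for k
      by (induction k) (use no_gap in auto)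
    have "summable (\<lambda>k. 1 / real (m k))"
    proof (subst summable_Suc_iff[symmetric], rule bounded_imp_summable)
      fix n
      have "s (Suc n) \<le> s (N + Suc n)" unfolding s_def by (rule sum_mono2) auto
      moreover have "n0 \<le> N + Suc n" by (simp add: N_def)
      ultimately have "s (Suc n) \<le> x" using r_pos[of "N + Suc n"] unfolding r_def by linarith
      then show "(\<Sum>k\<le>n. 1 / real (m (Suc k))) \<le> x"
        unfolding s_def by (simp add: sum.atLeast1_atMost_eq flip: lessThan_Suc_atMost)
    qed simp
    then have "summable (\<lambda>k. 1 / real (m (k + N)))" by (subst summable_iff_shift)
    then have "summable (\<lambda>k. inverse (real (k + m N)))" using arith by (simp add: add.commute inverse_eq_divide)
    then have "summable (\<lambda>k. inverse (real k))" by (subst (asm) summable_iff_shift)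
    then show False using not_summable_harmonic by blast
  qed
  \<comment> \<open>Gaps persist: after the greedy denominator a the remainder is at most
    1/(a(a-1)), and a >= 3 by the preceding gap, so the next denominator exceeds 2a.\<close>
  have gap: "m n + 1 < m (Suc n)" if "n1 \<le> n" for n
    using that
  proof (induction n rule: dec_induct)
    case (step n)
    define a where "a = m (Suc n)"
    have "0 < m n" using m(1)[of n] step n1 by (auto simp: N_def)
    then have a: "3 \<le> a" using step by (simp add: a_def)
    have "r (Suc n) \<le> 1 / (real a - 1) - 1 / a"
      using greedy(1)[of n] step n1 by (simp add: r_Suc a_def)
    also have "\<dots> = 1 / (real a * (real a - 1))" using a by (simp add: field_simps)
    also have "\<dots> \<le> 1 / (real a * 2)" using a by (intro divide_left_mono mult_left_mono) auto
    finally have "1 / m (Suc (Suc n)) < 1 / (real a * 2)"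
      using r_pos[of "Suc (Suc n)"] step n1 by (simp add: r_Suc N_def)
    then have "real a * 2 < m (Suc (Suc n))" using a m(1)[of "Suc (Suc n)"] by (simp add: field_simps)
    then show ?case using a by (simp add: a_def)
  qed (rule n1)
  have iter: "(greedy_rest ^^ i) (r n) = r (n + i)" if "n1 \<le> n" for n i
    by (induction i) (use greedy gap that n1 in auto)
  have not_improvable: "\<not> improvable (r n)" if n: "n1 \<le> n" for n
  proof
    assume "improvable (r n)"
    then obtain b :: nat where b: "real (m (Suc n)) + 1 < b"
      "1 / m (Suc n) + 1 / m (Suc (Suc n)) < 1 / (real (m (Suc n)) + 1) + 1 / b"
      "1 / (real (m (Suc n)) + 1) + 1 / b < r n"
      using greedy[of n] greedy[of "Suc n"] gap[of n] gap[of "Suc n"] n n1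
      unfolding improvable_def by auto
    \<comment> \<open>The improving pair is an admissible continuation of the first \<open>n\<close>
      terms, contradicting optimality with \<open>n + 2\<close> terms.\<close>
    have "m n < m (Suc n) + 1" "m (Suc n) + 1 < b" using gap[OF n] b(1) by linarith+
    then show False using ext2[of n "m (Suc n) + 1" b] b n n1 by (auto simp: N_def add.commute)
  qed
  have ge: "k \<le> m k" if "1 \<le> k" for k
    using that
  proof (induction k rule: dec_induct)
    case (step k)
    then show ?case using mono[of k "Suc k"] by simp
  qed (use m(1)[of 1] in simp)
  \<comment> \<open>The shift by 100 gives \<open>m (Suc n)\<close> at least 101, which puts the
    remainder into (0, 1/100].\<close>
  define n where "n = n1 + 100"
  have "r n \<le> 1 / (real (m (Suc n)) - 1)" using greedy(1)[of n] gap[of n] n1 by (simp add: n_def)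
  also have "\<dots> \<le> 1 / 100" using ge[of "Suc n"] by (intro divide_left_mono) (auto simp: n_def)
  finally have "r n \<le> 1 / 100" .
  moreover have "r n \<in> never_improvable"
    using not_improvable iter[of n] r_pos[of n] n1 by (auto simp: never_improvable_def n_def N_def)
  moreover have "s n \<in> \<rat>" unfolding s_def by (intro Rats_sum) auto
  ultimately show ?thesis using that[of "s n"] r_pos[of n] n1 by (auto simp: r_def n_def N_def)
qed

theorem theorem1:
  shows "{x :: real. 0 < x \<and> eventually_greedy_best x} \<in> null_sets lebesgue"
proof -
  define E where "E = never_improvable \<inter> {0<..1 / 100}"
  have "negligible E" using never_improvable_null by (simp add: E_def negligible_iff_null_sets)
  then have "negligible (\<Union>q\<in>\<rat>. (+) q ` E)"
    by (intro negligible_countable_Union) (auto simp: countable_rat intro: negligible_translation)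
  moreover have "{x. 0 < x \<and> eventually_greedy_best x} \<subseteq> (\<Union>q\<in>\<rat>. (+) q ` E)"
  proof
    fix x :: real assume "x \<in> {x. 0 < x \<and> eventually_greedy_best x}"
    then obtain q where "q \<in> \<rat>" "x - q \<in> E"
      using eventually_greedy_remainder[of x] unfolding E_def by blast
    then show "x \<in> (\<Union>q\<in>\<rat>. (+) q ` E)" by (intro UN_I[of q] image_eqI[of _ _ "x - q"]) auto
  qed
  \<comment> \<open>Lebesgue measure is complete, so measurability of the set comes from its being
    contained in a null set.\<close>
  ultimately show ?thesis unfolding negligible_iff_null_sets[symmetric] by (rule negligible_subset)
qed

end
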